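(* Let $n\ge 2$ be an integer, let $0<\gamma<1$, let $\ell$ be an integer with $-n\le\ell\le -1$, and let $t>0$. Let $B_n$ be the cardinal B-spline of degree $n$. Then $$\frac{1}{\Gamma(1-\gamma)}\int_0^{-\ell}\frac{B_n'(\tau)}{(t-\ell-\tau)^{\gamma}}\,d\tau=\frac{1}{\Gamma(n+1-\gamma)}\sum_{r=0}^{-\ell-1}(-1)^r\binom{n+1}{r}\Bigl((t-\ell-r)^{n-\gamma}+t^{1-\gamma}\sum_{p=0}^{n-1}\frac{(-1)^{n-p}(-\ell-r)^{n-1-p}(t-\ell-r)^p}{(n-1-p)!}\prod_{s=1}^{n-1-p}(\gamma-s)\Bigr),$$ where the empty product (for $p=n-1$) equals $1$.
   Context: The cardinal B-spline of integer degree $n$ is $B_n(t)=\frac{1}{n!}\Delta^{n+1}T_n(t)$, where $T_n(t)=(\max(0,t))^n$ is the truncated power function and $\Delta^{N}f(t)=\sum_{r=0}^{N}\binom{N}{r}(-1)^r f(t-r)$ is the backward finite difference operator. $B_n$ is a piecewise polynomial of degree $n$ with integer breakpoints, supported on $[0,n+1]$ and of class $C^{n-1}$. $\Gamma$ denotes Euler's gamma function. *)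

theory Defs
  imports "HOL-Analysis.Analysis"
begin

(* For n = 0 the convention 0 ^ 0 = 1 makes this the constant 1 rather than the Heaviside
   function, so cardinal_bspline 0 below is not the box function. Only n \<ge> 1 is meaningful. *)
definition truncated_power :: "nat \<Rightarrow> real \<Rightarrow> real" where
  "truncated_power n t = (max 0 t) ^ n"

definition backward_diff :: "nat \<Rightarrow> (real \<Rightarrow> real) \<Rightarrow> real \<Rightarrow> real" where
  "backward_diff N f t = (\<Sum>r = 0..N. real (N choose r) * (-1) ^ r * f (t - real r))"

definition cardinal_bspline :: "nat \<Rightarrow> real \<Rightarrow> real" where
  "cardinal_bspline n t = 1 / fact n * backward_diff (n + 1) (truncated_power n) t"

end

theory Submission
  imports Defs
begin

text \<open>
  The derivative of the B-spline is, for degree at least two, an everywhere valid finite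
  combination of shifted truncated powers, so the fractional integral splits into integrals
  \<open>\<integral> (\<tau> - r)^N (Y - \<tau>) powr (\<beta> - 1) d\<tau>\<close> over \<open>[r, m]\<close>, where \<open>m = -l\<close>, \<open>Y = t + m\<close>,
  \<open>\<beta> = 1 - \<gamma>\<close> and \<open>N = n - 1\<close>.  The truncated powers with knots \<open>r \<ge> m\<close> vanish on \<open>[0, m]\<close>,
  which is why only the knots below \<open>m\<close> survive on the right-hand side.

  Each remaining integral is an incomplete beta integral, and it is elementary because the
  exponent \<open>N\<close> is a natural number.  The explicit antiderivative comes from the binomial series
  \<open>(1 - u/X) powr (-\<beta>) = (\<Sum>k. pochhammer \<beta> k / fact k * (u/X)^k)\<close>: if \<open>Q\<close> is \<open>X^N\<close> times the
  partial sum up to \<open>k = N\<close>, then \<open>(X - u) powr \<beta> * Q u\<close> agrees with the constant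
  \<open>X powr (N + \<beta>)\<close> up to order \<open>u^N\<close>, and its derivative is exactly a multiple of the single
  monomial \<open>u^N\<close> times \<open>(X - u) powr (\<beta> - 1)\<close>
  (\<open>truncated_binomial_series_deriv\<close>, \<open>incomplete_beta_integral\<close>).
  The inner sum in the theorem is minus this partial sum, read from its last term and with
  \<open>pochhammer (1 - \<gamma>) k\<close> written as a signed product; the two Gamma values enter through their
  quotient \<open>pochhammer (1 - \<gamma>) n\<close>.
\<close>

section \<open>Derivatives of truncated powers and B-splines\<close>

text \<open>
  At the knot both one-sided derivatives are \<open>0\<close> because \<open>n \<ge> 1\<close>.  The formula therefore holds
  at every point, and no exceptional set has to be removed from the integrals below.
\<close>

lemma truncated_power_deriv:
  assumes "n \<ge> 1"
  shows "(truncated_power (Suc n) has_real_derivative real (Suc n) * truncated_power n x) (at x)"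
proof -
  consider "x < 0" | "x > 0" | "x = 0" by linarith
  then show ?thesis
  proof cases
    case 1
    have "((\<lambda>_. 0) has_real_derivative 0) (at x)" by simp
    then have "(truncated_power (Suc n) has_real_derivative 0) (at x)"
      by (rule has_field_derivative_transform_within_open[of _ _ _ "{..<0}"])
        (use 1 in \<open>auto simp: truncated_power_def\<close>)
    then show ?thesis using 1 assms by (simp add: truncated_power_def power_0_left)
  next
    case 2
    have "((\<lambda>x. x ^ Suc n) has_real_derivative real (Suc n) * x ^ n) (at x)"
      using DERIV_pow[of "Suc n" x UNIV] by simp
    then have "(truncated_power (Suc n) has_real_derivative real (Suc n) * x ^ n) (at x)"
      by (rule has_field_derivative_transform_within_open[of _ _ _ "{0<..}"])
        (use 2 in \<open>auto simp: truncated_power_def\<close>)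
    then show ?thesis using 2 by (simp add: truncated_power_def)
  next
    case 3
    have "((\<lambda>h. (max 0 h) ^ n) \<longlongrightarrow> (max 0 (0::real)) ^ n) (at 0)"
      by (intro tendsto_intros)
    then have "((\<lambda>h. (truncated_power (Suc n) (0 + h) - truncated_power (Suc n) 0) / h)
        \<longlongrightarrow> 0) (at 0)"
      by (rule tendsto_eq_rhs[OF Lim_transform_eventually])
        (use assms in \<open>auto simp: truncated_power_def max_def eventually_at_filter power_0_left\<close>)
    then show ?thesis using 3 assms by (simp add: DERIV_def truncated_power_def power_0_left)
  qed
qed

lemma cardinal_bspline_deriv:
  assumes "n \<ge> 1"
  shows "deriv (cardinal_bspline (Suc n)) x = 1 / fact n * backward_diff (n + 2) (truncated_power n) x"
proof (rule DERIV_imp_deriv)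
  have shift: "((\<lambda>x. truncated_power (Suc n) (x - c)) has_real_derivative
      real (Suc n) * truncated_power n (x - c)) (at x)" for c
    using DERIV_shift[of "truncated_power (Suc n)" _ x "- c"] truncated_power_deriv[OF assms, of "x - c"]
    by simp
  have "((\<lambda>x. 1 / fact (Suc n) * (\<Sum>r = 0..n + 2. real ((n + 2) choose r) * (-1) ^ r *
        truncated_power (Suc n) (x - real r))) has_real_derivative
      1 / fact (Suc n) * (\<Sum>r = 0..n + 2. real ((n + 2) choose r) * (-1) ^ r *
        (real (Suc n) * truncated_power n (x - real r)))) (at x)"
    by (intro DERIV_cmult DERIV_sum shift)
  moreover have "1 / fact (Suc n) * (\<Sum>r = 0..n + 2. real ((n + 2) choose r) * (-1) ^ r *
        (real (Suc n) * truncated_power n (x - real r)))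
      = 1 / fact n * backward_diff (n + 2) (truncated_power n) x"
    unfolding backward_diff_def sum_distrib_left
    by (intro sum.cong refl) (simp add: field_simps del: of_nat_Suc)
  moreover have "cardinal_bspline (Suc n) = (\<lambda>x. 1 / fact (Suc n) *
      (\<Sum>r = 0..n + 2. real ((n + 2) choose r) * (-1) ^ r * truncated_power (Suc n) (x - real r)))"
    by (simp add: cardinal_bspline_def backward_diff_def fun_eq_iff)
  ultimately show "(cardinal_bspline (Suc n) has_real_derivative
      1 / fact n * backward_diff (n + 2) (truncated_power n) x) (at x)"
    by simp
qed

section \<open>An incomplete beta integral\<close>

text \<open>
  The partial sum of the binomial series of \<open>X^N * (1 - u/X) powr (-\<beta>)\<close>, with the powers of \<open>X\<close>
  multiplied out so that it is a homogeneous polynomial in \<open>u\<close> and \<open>X\<close>.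
\<close>

definition truncated_binomial_series :: "real \<Rightarrow> nat \<Rightarrow> real \<Rightarrow> real \<Rightarrow> real" where
  "truncated_binomial_series \<beta> N X u = (\<Sum>k\<le>N. pochhammer \<beta> k / fact k * u ^ k * X ^ (N - k))"

lemma truncated_binomial_series_0 [simp]: "truncated_binomial_series \<beta> 0 X u = 1"
  by (simp add: truncated_binomial_series_def)

lemma truncated_binomial_series_Suc:
  "truncated_binomial_series \<beta> (Suc N) X u =
    X * truncated_binomial_series \<beta> N X u + pochhammer \<beta> (Suc N) / fact (Suc N) * u ^ Suc N"
  by (simp add: truncated_binomial_series_def sum_distrib_left Suc_diff_le algebra_simps)

lemma truncated_binomial_series_at_0: "truncated_binomial_series \<beta> N X 0 = X ^ N"
  by (induction N) (simp_all add: truncated_binomial_series_Suc)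

text \<open>
  With the full series in place of the partial sum the product would be constant, so the
  derivative consists only of the truncation error.  That this is a single monomial is seen by
  induction: raising \<open>N\<close> multiplies the polynomial by \<open>X\<close> and adds one monomial.  With
  \<open>X = (X - u) + u\<close> in the derivative of the old part, the contribution of \<open>X - u\<close> cancels
  against the derivative of the new monomial, and the contribution of \<open>u\<close> raises \<open>u^N\<close> to
  \<open>u^(N+1)\<close>.
\<close>

lemma truncated_binomial_series_deriv:
  assumes "u < X"
  shows "((\<lambda>u. (X - u) powr \<beta> * truncated_binomial_series \<beta> N X u) has_real_derivative
      - (pochhammer \<beta> (Suc N) / fact N) * (u ^ N * (X - u) powr (\<beta> - 1))) (at u)"
proof (induction N)
  case 0
  show ?case using assms
    by (auto intro!: derivative_eq_intros)
next
  case (Suc N)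
  let ?c = "pochhammer \<beta> (Suc N) / fact (Suc N)"
  have weight: "((\<lambda>u. (X - u) powr \<beta>) has_real_derivative - (\<beta> * (X - u) powr (\<beta> - 1))) (at u)"
    using assms by (auto intro!: derivative_eq_intros)
  have monomial: "((\<lambda>u. u ^ Suc N) has_real_derivative real (Suc N) * u ^ N) (at u)"
    using DERIV_pow[of "Suc N" u UNIV] by simp
  have step: "((\<lambda>u. X * ((X - u) powr \<beta> * truncated_binomial_series \<beta> N X u)
        + ?c * ((X - u) powr \<beta> * u ^ Suc N)) has_real_derivative
      X * (- (pochhammer \<beta> (Suc N) / fact N) * (u ^ N * (X - u) powr (\<beta> - 1)))
        + ?c * ((- (\<beta> * (X - u) powr (\<beta> - 1))) * u ^ Suc N
          + real (Suc N) * u ^ N * (X - u) powr \<beta>)) (at u)"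
    by (intro DERIV_add DERIV_cmult Suc.IH DERIV_mult weight monomial)
  have c: "pochhammer \<beta> (Suc N) / fact N = real (Suc N) * ?c"
    by (simp add: field_simps del: of_nat_Suc)
  have c': "pochhammer \<beta> (Suc (Suc N)) / fact (Suc N) = (\<beta> + real (Suc N)) * ?c"
    by (simp add: pochhammer_Suc[of \<beta> "Suc N"])
  have w: "(X - u) powr \<beta> = (X - u) * (X - u) powr (\<beta> - 1)"
    using assms powr_mult_base[of "X - u" "\<beta> - 1"] by simp
  have val: "X * (- (pochhammer \<beta> (Suc N) / fact N) * (u ^ N * (X - u) powr (\<beta> - 1)))
        + ?c * ((- (\<beta> * (X - u) powr (\<beta> - 1))) * u ^ Suc N
          + real (Suc N) * u ^ N * (X - u) powr \<beta>)
      = - (pochhammer \<beta> (Suc (Suc N)) / fact (Suc N)) * (u ^ Suc N * (X - u) powr (\<beta> - 1))"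
    unfolding c c' w power_Suc
    by (simp add: algebra_simps add_divide_distrib del: of_nat_Suc fact_Suc)
  have "(\<lambda>u. (X - u) powr \<beta> * truncated_binomial_series \<beta> (Suc N) X u) =
      (\<lambda>u. X * ((X - u) powr \<beta> * truncated_binomial_series \<beta> N X u)
        + ?c * ((X - u) powr \<beta> * u ^ Suc N))"
    by (simp add: truncated_binomial_series_Suc algebra_simps)
  with step val show ?case by simp
qed

text \<open>
  The strict bound \<open>b < Y\<close> keeps the singularity of the weight outside the interval, so the
  antiderivative of the preceding lemma, taken at \<open>u = \<tau> - c\<close> with \<open>X = Y - c\<close>, is differentiable up
  to both end points.
\<close>

lemma incomplete_beta_integral:
  assumes "\<beta> > 0" "c \<le> b" "b < Y"
  shows "((\<lambda>\<tau>. (\<tau> - c) ^ N * (Y - \<tau>) powr (\<beta> - 1)) has_integral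
      fact N / pochhammer \<beta> (Suc N) * ((Y - c) powr (\<beta> + real N)
        - (Y - b) powr \<beta> * truncated_binomial_series \<beta> N (Y - c) (b - c))) {c..b}"
proof -
  let ?F = "\<lambda>u. (Y - c - u) powr \<beta> * truncated_binomial_series \<beta> N (Y - c) u"
  let ?K = "fact N / pochhammer \<beta> (Suc N)"
  have poch: "pochhammer \<beta> (Suc N) > 0"
    using assms(1) by (rule pochhammer_pos)
  have antideriv: "((\<lambda>\<tau>. - ?K * ?F (\<tau> - c)) has_vector_derivative
      (\<tau> - c) ^ N * (Y - \<tau>) powr (\<beta> - 1)) (at \<tau> within {c..b})" if "\<tau> \<in> {c..b}" for \<tau>
  proof -
    have "(?F has_real_derivative - (pochhammer \<beta> (Suc N) / fact N) *
        ((\<tau> - c) ^ N * (Y - c - (\<tau> - c)) powr (\<beta> - 1))) (at (\<tau> - c))"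
      using that assms by (intro truncated_binomial_series_deriv) auto
    then have "((\<lambda>\<tau>. ?F (\<tau> + - c)) has_real_derivative - (pochhammer \<beta> (Suc N) / fact N) *
        ((\<tau> - c) ^ N * (Y - \<tau>) powr (\<beta> - 1))) (at \<tau>)"
      by (subst DERIV_shift[symmetric]) (simp add: algebra_simps)
    then have shifted: "((\<lambda>\<tau>. ?F (\<tau> - c)) has_real_derivative
        - (pochhammer \<beta> (Suc N) / fact N) * ((\<tau> - c) ^ N * (Y - \<tau>) powr (\<beta> - 1))) (at \<tau>)"
      by (simp only: add_uminus_conv_diff)
    have "- ?K * (- (pochhammer \<beta> (Suc N) / fact N) *
        ((\<tau> - c) ^ N * (Y - \<tau>) powr (\<beta> - 1))) = (\<tau> - c) ^ N * (Y - \<tau>) powr (\<beta> - 1)"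
      using poch by (simp add: field_simps)
    with DERIV_cmult[OF shifted]
    have "((\<lambda>\<tau>. - ?K * ?F (\<tau> - c)) has_real_derivative
        (\<tau> - c) ^ N * (Y - \<tau>) powr (\<beta> - 1)) (at \<tau>)"
      by (rule DERIV_cong)
    then show ?thesis
      unfolding has_real_derivative_iff_has_vector_derivative
      by (rule has_vector_derivative_at_within)
  qed
  have "((\<lambda>\<tau>. (\<tau> - c) ^ N * (Y - \<tau>) powr (\<beta> - 1)) has_integral
      (- ?K * ?F (b - c) - - ?K * ?F (c - c))) {c..b}"
    using assms(2) antideriv by (rule fundamental_theorem_of_calculus)
  moreover have "?F (c - c) = (Y - c) powr (\<beta> + real N)"
    using assms by (simp add: truncated_binomial_series_at_0 powr_add powr_realpow)
  moreover have "?F (b - c) = (Y - b) powr \<beta> * truncated_binomial_series \<beta> N (Y - c) (b - c)"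
    by simp
  ultimately show ?thesis by (simp add: right_diff_distrib)
qed

text \<open>
  The truncated power vanishes to the left of its knot, so terms with different knots can be
  integrated over one common interval.
\<close>

lemma truncated_power_integral:
  assumes "\<beta> > 0" "N \<ge> 1" "0 \<le> c" "c \<le> b" "b < Y"
  shows "((\<lambda>\<tau>. truncated_power N (\<tau> - c) * (Y - \<tau>) powr (\<beta> - 1)) has_integral
      fact N / pochhammer \<beta> (Suc N) * ((Y - c) powr (\<beta> + real N)
        - (Y - b) powr \<beta> * truncated_binomial_series \<beta> N (Y - c) (b - c))) {0..b}"
proof -
  let ?f = "\<lambda>\<tau>. truncated_power N (\<tau> - c) * (Y - \<tau>) powr (\<beta> - 1)"
  have "(?f has_integral 0) {0..c}"
    by (rule has_integral_is_0) (use assms(2) in \<open>auto simp: truncated_power_def max_def\<close>)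
  moreover have "(?f has_integral fact N / pochhammer \<beta> (Suc N) * ((Y - c) powr (\<beta> + real N)
        - (Y - b) powr \<beta> * truncated_binomial_series \<beta> N (Y - c) (b - c))) {c..b}"
    using incomplete_beta_integral[OF assms(1,4,5), of N]
    by (rule has_integral_eq[rotated]) (auto simp: truncated_power_def)
  ultimately show ?thesis
    using has_integral_combine[OF assms(3,4)] by fastforce
qed

section \<open>The fractional integral of the B-spline\<close>

lemma prod_diff_conv_pochhammer:
  "(\<Prod>s = 1..k. \<gamma> - real s) = (-1) ^ k * pochhammer (1 - \<gamma>) k"
  by (induction k) (simp_all add: pochhammer_Suc algebra_simps)

text \<open>
  The substitution \<open>k = N - p\<close> turns the inner sum of the theorem into the partial sum.  The sign
  \<open>(-1)^(k+1)\<close> and the \<open>(-1)^k\<close> from the product of the \<open>\<gamma> - s\<close> leave one minus sign,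
  which is the sign of the lower-limit term when the integral is written in the variable \<open>Y - \<tau>\<close>.
\<close>

lemma truncated_binomial_series_alt:
  "(\<Sum>p = 0..N. (-1) ^ (Suc N - p) * a ^ (N - p) * X ^ p / fact (N - p)
      * (\<Prod>s = 1..N - p. \<gamma> - real s)) = - truncated_binomial_series (1 - \<gamma>) N X a"
proof -
  have "(\<Sum>p = 0..N. (-1) ^ (Suc N - p) * a ^ (N - p) * X ^ p / fact (N - p)
      * (\<Prod>s = 1..N - p. \<gamma> - real s))
    = (\<Sum>k = 0..N. (-1) ^ (Suc N - (N - k)) * a ^ (N - (N - k)) * X ^ (N - k) / fact (N - (N - k))
      * (\<Prod>s = 1..N - (N - k). \<gamma> - real s))"
    by (subst sum.atLeastAtMost_rev) simp
  also have "\<dots> = (\<Sum>k = 0..N. - (pochhammer (1 - \<gamma>) k / fact k * a ^ k * X ^ (N - k)))"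
  proof (rule sum.cong[OF refl])
    fix k assume "k \<in> {0..N}"
    then have k: "N - (N - k) = k" "Suc N - (N - k) = Suc k" by auto
    have "(-1) ^ k * (-1) ^ k = (1::real)"
      by (simp flip: power_mult_distrib)
    then show "(-1) ^ (Suc N - (N - k)) * a ^ (N - (N - k)) * X ^ (N - k) / fact (N - (N - k))
        * (\<Prod>s = 1..N - (N - k). \<gamma> - real s)
      = - (pochhammer (1 - \<gamma>) k / fact k * a ^ k * X ^ (N - k))"
      unfolding k prod_diff_conv_pochhammer by (simp add: field_simps)
  qed
  finally show ?thesis
    by (simp add: truncated_binomial_series_def sum_negf atLeast0AtMost)
qed

theorem theorem3p2:
  fixes n :: nat and \<gamma> t :: real and l :: int
  assumes "n \<ge> 2"
    and "0 < \<gamma>" and "\<gamma> < 1"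
    and "- int n \<le> l" and "l \<le> -1"
    and "t > 0"
  shows "1 / Gamma (1 - \<gamma>) *
      integral {0..- real_of_int l}
        (\<lambda>\<tau>. deriv (cardinal_bspline n) \<tau> / (t - real_of_int l - \<tau>) powr \<gamma>)
    = 1 / Gamma (real n + 1 - \<gamma>) *
      (\<Sum>r = 0..nat (- l - 1). (-1) ^ r * real ((n + 1) choose r) *
        ((t - real_of_int l - real r) powr (real n - \<gamma>)
         + t powr (1 - \<gamma>) *
           (\<Sum>p = 0..n - 1.
              (-1) ^ (n - p) * (- real_of_int l - real r) ^ (n - 1 - p)
                * (t - real_of_int l - real r) ^ p / fact (n - 1 - p)
                * (\<Prod>s = 1..n - 1 - p. \<gamma> - real s))))"
proof -
  define m where "m = nat (- l)"
  define N where "N = n - 1"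
  define Y where "Y = t + real m"
  define \<beta> where "\<beta> = 1 - \<gamma>"
  have n: "n = Suc N" and N: "N \<ge> 1" using assms(1) by (auto simp: N_def)
  have l: "l = - int m" and m: "m \<ge> 1" "m \<le> n" using assms by (auto simp: m_def)
  have \<beta>: "\<beta> > 0" using assms by (simp add: \<beta>_def)
  let ?w = "\<lambda>r. real ((N + 2) choose r) * (-1) ^ r"
  let ?V = "\<lambda>r. (Y - real r) powr (\<beta> + real N)
      - t powr \<beta> * truncated_binomial_series \<beta> N (Y - real r) (real m - real r)"
  let ?K = "fact N / pochhammer \<beta> (Suc N)"
  let ?g = "\<lambda>r \<tau>. truncated_power N (\<tau> - real r) * (Y - \<tau>) powr (\<beta> - 1)"
  have knot: "(?g r has_integral (if r < m then ?K * ?V r else 0)) {0..real m}" for r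
  proof (cases "r < m")
    case True
    then show ?thesis
      using truncated_power_integral[OF \<beta> N, of "real r" "real m" Y] assms(6)
      by (simp add: Y_def)
  next
    case False
    then have "(?g r has_integral 0) {0..real m}"
      by (intro has_integral_is_0) (use N in \<open>auto simp: truncated_power_def max_def\<close>)
    with False show ?thesis by simp
  qed
  have "((\<lambda>\<tau>. 1 / fact N * (\<Sum>r = 0..N + 2. ?w r * ?g r \<tau>)) has_integral
      1 / fact N * (\<Sum>r = 0..N + 2. ?w r * (if r < m then ?K * ?V r else 0))) {0..real m}"
    by (intro has_integral_mult_right has_integral_sum knot) auto
  moreover have "(\<Sum>r = 0..N + 2. ?w r * (if r < m then ?K * ?V r else 0))
      = (\<Sum>r = 0..m - 1. ?w r * (?K * ?V r))"
    by (intro sum.mono_neutral_cong_right) (use m n in auto)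
  moreover have "1 / fact N * (\<Sum>r = 0..m - 1. ?w r * (?K * ?V r))
      = 1 / pochhammer \<beta> (Suc N) * (\<Sum>r = 0..m - 1. ?w r * ?V r)"
    unfolding sum_distrib_left
    by (intro sum.cong refl) (simp add: mult_ac)
  moreover have "1 / fact N * (\<Sum>r = 0..N + 2. ?w r * ?g r \<tau>)
      = deriv (cardinal_bspline n) \<tau> / (Y - \<tau>) powr \<gamma>" for \<tau>
  proof -
    have "(Y - \<tau>) powr (\<beta> - 1) = 1 / (Y - \<tau>) powr \<gamma>"
      by (simp add: \<beta>_def powr_minus_divide)
    then show ?thesis
      unfolding n cardinal_bspline_deriv[OF N] backward_diff_def
      by (simp add: sum_divide_distrib mult_ac del: binomial_Suc_Suc sum.cl_ivl_Suc)
  qed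
  ultimately have "integral {0..real m} (\<lambda>\<tau>. deriv (cardinal_bspline n) \<tau> / (Y - \<tau>) powr \<gamma>)
      = 1 / pochhammer \<beta> (Suc N) * (\<Sum>r = 0..m - 1. ?w r * ?V r)"
    by (simp add: integral_unique)
  moreover have "1 / Gamma \<beta> * (1 / pochhammer \<beta> (Suc N)) = 1 / Gamma (real n + 1 - \<gamma>)"
  proof -
    have "\<beta> \<notin> \<int>\<^sub>\<le>\<^sub>0" using \<beta> by (auto elim!: nonpos_Ints_cases)
    from pochhammer_Gamma[OF this, of "Suc N"]
    have "pochhammer \<beta> (Suc N) = Gamma (real n + 1 - \<gamma>) / Gamma \<beta>"
      by (simp add: n \<beta>_def algebra_simps)
    moreover have "Gamma \<beta> > 0" using \<beta> by (rule Gamma_real_pos)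
    ultimately show ?thesis by simp
  qed
  ultimately have main: "1 / Gamma \<beta> *
      integral {0..real m} (\<lambda>\<tau>. deriv (cardinal_bspline n) \<tau> / (Y - \<tau>) powr \<gamma>)
      = 1 / Gamma (real n + 1 - \<gamma>) * (\<Sum>r = 0..m - 1. ?w r * ?V r)"
    by (simp only: mult.assoc[symmetric])
  have Y: "t - real_of_int l = Y" "- real_of_int l = real m" "nat (- l - 1) = m - 1"
    using m by (auto simp: Y_def l)
  have val: "(-1) ^ r * real ((n + 1) choose r) *
        ((Y - real r) powr (real n - \<gamma>) + t powr (1 - \<gamma>) *
           (\<Sum>p = 0..n - 1. (-1) ^ (n - p) * (real m - real r) ^ (n - 1 - p)
                * (Y - real r) ^ p / fact (n - 1 - p) * (\<Prod>s = 1..n - 1 - p. \<gamma> - real s)))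
      = ?w r * ?V r" for r
    using truncated_binomial_series_alt[of N "real m - real r" "Y - real r" \<gamma>]
    by (simp add: n \<beta>_def algebra_simps del: binomial_Suc_Suc sum.cl_ivl_Suc)
  show ?thesis
    unfolding Y val using main by (simp add: \<beta>_def)
qed

end
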